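(* Let $A,B\subset\mathbb{R}^n$ and let $x\in\mathbb{R}^n$. Then the following properties hold. \begin{enumerate} \item (Bounds) If $x\in\overline A$, then $0\le\dim_{\times}\{x\}_A\le\dim_{\mathrm{Ptan}}\{x\}_A\le n$. \item (Locality) If $x\in\overline A\cap\overline B$, and if there exists a neighborhood $U$ of $x$ such that $A\cap U=B\cap U$, then $\dim_{\times}\{x\}_A=\dim_{\times}\{x\}_B$. \item (Monotonicity) If $A\subset B$, then for every $x\in\overline A$, $\dim_{\times}\{x\}_A\le\dim_{\times}\{x\}_B$. \item (Closure invariance) For every $x\in\overline A$, $\dim_{\times}\{x\}_A=\dim_{\times}\{x\}_{\overline A}$. \item (Dense-subset invariance) If $D\subset A$ is dense in $A$, equivalently $\overline D=\overline A$, then $\dim_{\times}\{x\}_D=\dim_{\times}\{x\}_A$ for all $x\in\overline A$, and consequently $\dim_{\times}(D)=\dim_{\times}(A)$. \end{enumerate}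
   Context: Tangent cone: $\mathrm{Tan}_x(A)$ is the set of $v\in\mathbb{R}^n$ for which there exist $x_k\in A$, $x_k\to x$, and positive reals $\lambda_k\downarrow0$ with $(x_k-x)/\lambda_k\to v$. Point-tangential dimension: $\dim_{\mathrm{Ptan}}\{x\}_A:=\dim\mathrm{span}(\mathrm{Tan}_x(A))$, with $\mathrm{span}(\varnothing)=\{0\}$. Effective directions: $\mathrm{Eff}_x(A):=\mathrm{Tan}_x(A)\cap S^{n-1}$ if $x\in\overline A$ (and $\varnothing$ otherwise). For $v\ne0$ let $[v]=\mathbb{R}v\in\mathbb{P}^{n-1}$; $\mathrm{Eff}_x^{\mathbb P}(A):=\{[v]:v\in\mathrm{Eff}_x(A)\}$. Admissible probes: for $x\in\overline A$, $v\in S^{n-1}$, $\mathcal G_x^A(v)$ is the family of all injective Lipschitz maps $\gamma:[0,\delta]\to\mathbb{R}^n$ (some $\delta>0$) with $\gamma(0)=x$, $\lim_{t\to0^+}\frac{\gamma(t)-x}{\|\gamma(t)-x\|}=v$, and $A\cap\gamma((0,\eta])\ne\varnothing$ for every $\eta\in(0,\delta]$; $\Gamma_\gamma:=\gamma([0,\delta])$. Point-extended box dimension: for bounded $E$, $N_\varepsilon(E)$ is the minimal number of sets of diameter at most $\varepsilon$ covering $E$ and $\overline{\dim}_B(E):=\limsup_{\varepsilon\to0}\frac{\ln N_\varepsilon(E)}{\ln(1/\varepsilon)}$. For $x\in\overline E$, $\dim_{\mathrm{Pbox}}\{x\}_E:=\inf_{r>0}\overline{\dim}_B(E\cap B(x,r))$;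 it is $0$ if $x\notin\overline E$. Directional contribution: for $v\in\mathrm{Eff}_x(A)$, $\theta_x^A(v):=\sup_{\gamma\in\mathcal G_x^A(v)}\dim_{\mathrm{Pbox}}\{x\}_{A\cap\Gamma_\gamma}$; for $\xi\in\mathrm{Eff}_x^{\mathbb P}(A)$, $\theta_x^A(\xi):=\sup\{\theta_x^A(w):w\in\mathrm{Eff}_x(A),[w]=\xi\}$. Point-Cross dimension at $x\in\overline A$: $\dim_\times\{x\}_A:=\sup\sum_{i=1}^m\theta_x^A(\xi_i)$ over all $m\in\{0,\dots,n\}$ and all $\xi_1,\dots,\xi_m\in\mathrm{Eff}_x^{\mathbb P}(A)$ that are projectively (linearly) independent, i.e. nonzero representatives are linearly independent (empty family allowed, with sum $0$). Globally, $\dim_\times(A):=\sup_{x\in\overline A}\dim_\times\{x\}_A$ if $A\neq\varnothing$, and $\dim_\times(\varnothing):=0$. *)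

theory Defs
  imports "HOL-Analysis.Analysis"
begin

text \<open>Extended reals are used for all dimension-valued suprema, infima and upper limits, so that
  no boundedness side conditions are hidden in them.\<close>

definition tangent_cone :: "real^'n \<Rightarrow> (real^'n) set \<Rightarrow> (real^'n) set" where
  "tangent_cone x A = {v. \<exists>(X :: nat \<Rightarrow> real^'n) (l :: nat \<Rightarrow> real).
     (\<forall>k. X k \<in> A) \<and> X \<longlonglongrightarrow> x \<and>
     (\<forall>k. l k > 0) \<and> decseq l \<and> l \<longlonglongrightarrow> 0 \<and>
     (\<lambda>k. (X k - x) /\<^sub>R l k) \<longlonglongrightarrow> v}"

definition ptan_dim :: "real^'n \<Rightarrow> (real^'n) set \<Rightarrow> nat" where
  "ptan_dim x A = dim (span (tangent_cone x A))"

definition eff_dirs :: "real^'n \<Rightarrow> (real^'n) set \<Rightarrow> (real^'n) set" where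
  "eff_dirs x A = (if x \<in> closure A then tangent_cone x A \<inter> sphere 0 1 else {})"

text \<open>Points of projective space are represented by the lines through the origin, as sets of
  vectors.\<close>

definition proj_pt :: "real^'n \<Rightarrow> (real^'n) set" where
  "proj_pt v = range (\<lambda>c::real. c *\<^sub>R v)"

definition proj_eff_dirs :: "real^'n \<Rightarrow> (real^'n) set \<Rightarrow> (real^'n) set set" where
  "proj_eff_dirs x A = proj_pt ` eff_dirs x A"

text \<open>A probe is a pair \<open>(\<delta>, \<gamma>)\<close>; only the values of \<open>\<gamma>\<close> on \<open>{0..\<delta>}\<close> matter.\<close>

definition probes :: "(real^'n) set \<Rightarrow> real^'n \<Rightarrow> real^'n \<Rightarrow> (real \<times> (real \<Rightarrow> real^'n)) set" where
  "probes A x v = {(\<delta>, \<gamma>). \<delta> > 0 \<and> inj_on \<gamma> {0..\<delta>} \<and> (\<exists>L. L-lipschitz_on {0..\<delta>} \<gamma>) \<and>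
     \<gamma> 0 = x \<and>
     ((\<lambda>t. (\<gamma> t - x) /\<^sub>R norm (\<gamma> t - x)) \<longlongrightarrow> v) (at_right 0) \<and>
     (\<forall>\<eta>. 0 < \<eta> \<and> \<eta> \<le> \<delta> \<longrightarrow> A \<inter> \<gamma> ` {0<..\<eta>} \<noteq> {})}"

text \<open>The explicit \<open>bounded\<close> is needed because \<open>diameter\<close> has no meaningful value on
  unbounded sets.\<close>

definition cover_num :: "real \<Rightarrow> (real^'n) set \<Rightarrow> nat" where
  "cover_num \<epsilon> E = (LEAST k. \<exists>F. finite F \<and> card F = k \<and>
     (\<forall>U\<in>F. bounded U \<and> diameter U \<le> \<epsilon>) \<and> E \<subseteq> \<Union>F)"

text \<open>Only meaningful for bounded sets; below it is applied to nonempty subsets of balls only.\<close>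

definition upper_box_dim :: "(real^'n) set \<Rightarrow> ereal" where
  "upper_box_dim E =
     Limsup (at_right 0) (\<lambda>\<epsilon>. ereal (ln (real (cover_num \<epsilon> E)) / ln (1 / \<epsilon>)))"

definition pbox_dim :: "real^'n \<Rightarrow> (real^'n) set \<Rightarrow> ereal" where
  "pbox_dim x E =
     (if x \<in> closure E then INF r\<in>{0<..}. upper_box_dim (E \<inter> ball x r) else 0)"

definition theta :: "(real^'n) set \<Rightarrow> real^'n \<Rightarrow> real^'n \<Rightarrow> ereal" where
  "theta A x v = (SUP (\<delta>, \<gamma>)\<in>probes A x v. pbox_dim x (A \<inter> \<gamma> ` {0..\<delta>}))"

definition theta_proj :: "(real^'n) set \<Rightarrow> real^'n \<Rightarrow> (real^'n) set \<Rightarrow> ereal" where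
  "theta_proj A x \<xi> = (SUP w\<in>{w \<in> eff_dirs x A. proj_pt w = \<xi>}. theta A x w)"

text \<open>Independence of the family \<open>w 1, \<dots>, w m\<close> (as opposed to the set of its values) is
  injectivity together with independence of the set of values.\<close>

definition proj_independent :: "nat \<Rightarrow> (nat \<Rightarrow> (real^'n) set) \<Rightarrow> bool" where
  "proj_independent m \<xi> \<longleftrightarrow>
     (\<forall>w. (\<forall>i\<in>{1..m}. w i \<in> \<xi> i \<and> w i \<noteq> 0) \<longrightarrow> inj_on w {1..m} \<and> independent (w ` {1..m}))"

definition cross_dim_at :: "real^'n \<Rightarrow> (real^'n) set \<Rightarrow> ereal" where
  "cross_dim_at x A =
     (SUP (m, \<xi>)\<in>{(m, \<xi>). m \<le> CARD('n) \<and> (\<forall>i\<in>{1..m}. \<xi> i \<in> proj_eff_dirs x A) \<and>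
                          proj_independent m \<xi>}.
        \<Sum>i=1..m. theta_proj A x (\<xi> i))"

definition cross_dim :: "(real^'n) set \<Rightarrow> ereal" where
  "cross_dim A = (if A = {} then 0 else SUP x\<in>closure A. cross_dim_at x A)"

end

(*
The only part that is not routine is closure invariance. Given a probe \<gamma> for the closure of A,
choose on its trace a set Q of points of the closure of A that accumulates only at x and still has
the local box dimension of the trace, up to an arbitrarily small loss. A map \<phi> = id + g, where g
is a sum of small bumps with disjoint supports, each pushing one point of Q into A, moves all of Q
into A at once. If g is 1/2-Lipschitz, then \<phi> is bi-Lipschitz, so \<phi> o \<gamma> is again injective and
Lipschitz and box dimensions survive; if g(y) = O(|y - x|^2), then its direction at x is unchanged.
*)
theory Submission
  imports Defs "HOL-Real_Asymp.Real_Asymp"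
begin

section \<open>Covering numbers and box dimension\<close>

text \<open>The obstacle is that a probe for \<open>closure A\<close> may miss \<open>A\<close>
  altogether. The curve itself has to change, yet it must stay injective, Lipschitz and tangent to
  the same direction. A map of the ambient space meets these requirements at once, whereas rerouting
  the curve point by point would endanger injectivity. A discrete set Q can carry the dimension
  because upper box dimension is not countably stable: the upper limit is witnessed by one scale at
  a time, and a finite separated set is enough for one scale. One scale and one finite set in each
  ball of radius 1/(k+1) about x serve all radii in the infimum and leave only finitely many points
  away from x. This discreteness is what makes room for disjoint bumps. The upper bound rests on
  another fact: a Lipschitz arc has box dimension at most 1, so m independent directions contribute
  at most m.\<close>

lemma cover_num_le_card:
  assumes "finite F" "\<And>U. U \<in> F \<Longrightarrow> bounded U \<and> diameter U \<le> \<epsilon>" "E \<subseteq> \<Union>F"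
  shows "cover_num \<epsilon> E \<le> card F"
  unfolding cover_num_def using assms by (intro Least_le) blast

lemma diameter_cball_half_le:
  fixes c :: "real^'n"
  assumes "\<epsilon> \<ge> 0"
  shows "diameter (cball c (\<epsilon>/2)) \<le> \<epsilon>"
proof (rule diameter_le)
  show "cball c (\<epsilon>/2) \<noteq> {} \<or> 0 \<le> \<epsilon>" using assms by simp
  fix y z assume "y \<in> cball c (\<epsilon>/2)" "z \<in> cball c (\<epsilon>/2)"
  then show "norm (y - z) \<le> \<epsilon>"
    using dist_triangle3[of y z c] by (simp add: dist_norm)
qed

text \<open>\<open>LEAST\<close> means something only once a finite cover exists; compactness of the
  closure supplies one by balls of radius \<epsilon>/2.\<close>

lemma cover_num_attained:
  fixes E :: "(real^'n) set"
  assumes "bounded E" "\<epsilon> > 0"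
  obtains F where "finite F" "card F = cover_num \<epsilon> E"
    "\<And>U. U \<in> F \<Longrightarrow> bounded U \<and> diameter U \<le> \<epsilon>" "E \<subseteq> \<Union>F"
proof -
  have "compact (closure E)" using assms by (simp add: compact_closure)
  then obtain C where C: "finite C" "closure E \<subseteq> (\<Union>c\<in>C. ball c (\<epsilon>/2))"
  proof (rule compactE_image[where C = UNIV and f = "\<lambda>c. ball c (\<epsilon>/2)"])
    show "closure E \<subseteq> (\<Union>c. ball c (\<epsilon>/2))"
    proof
      fix y assume "y \<in> closure E"
      show "y \<in> (\<Union>c. ball c (\<epsilon>/2))" using assms(2) by (intro UN_I[of y]) auto
    qed
  qed auto
  define F where "F = (\<lambda>c. cball c (\<epsilon>/2)) ` C"
  have "E \<subseteq> (\<Union>c\<in>C. ball c (\<epsilon>/2))" using closure_subset C(2) by (rule subset_trans)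
  also have "\<dots> \<subseteq> \<Union>F" unfolding F_def by (intro UN_mono) auto
  finally have "E \<subseteq> \<Union>F" .
  moreover have "bounded U \<and> diameter U \<le> \<epsilon>" if "U \<in> F" for U
    using that diameter_cball_half_le[of \<epsilon>] assms(2) by (auto simp: F_def)
  moreover have "finite F" using C(1) by (simp add: F_def)
  ultimately have "\<exists>k F. finite F \<and> card F = k \<and>
     (\<forall>U\<in>F. bounded U \<and> diameter U \<le> \<epsilon>) \<and> E \<subseteq> \<Union>F"
    by (intro exI[of _ "card F"] exI[of _ F]) auto
  from LeastI_ex[OF this] obtain F where "finite F" "card F = cover_num \<epsilon> E"
    "\<forall>U\<in>F. bounded U \<and> diameter U \<le> \<epsilon>" "E \<subseteq> \<Union>F"
    unfolding cover_num_def by (elim exE conjE)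
  then show ?thesis by (intro that[of F]) auto
qed

lemma cover_num_mono:
  fixes E E' :: "(real^'n) set"
  assumes "E \<subseteq> E'" "bounded E'" "\<epsilon> > 0"
  shows "cover_num \<epsilon> E \<le> cover_num \<epsilon> E'"
proof -
  obtain F where "finite F" "card F = cover_num \<epsilon> E'"
    "\<And>U. U \<in> F \<Longrightarrow> bounded U \<and> diameter U \<le> \<epsilon>" "E' \<subseteq> \<Union>F"
    using cover_num_attained[OF assms(2,3)] by metis
  then show ?thesis using cover_num_le_card[of F \<epsilon> E] assms(1) by auto
qed

text \<open>Pigeonhole: a set of diameter at most \<epsilon> contains at most one point of S, so
  choosing a covering set for each point is injective.\<close>

lemma card_separated_le_cover_num:
  fixes E :: "(real^'n) set"
  assumes "bounded E" "\<epsilon> > 0" "S \<subseteq> E" "pairwise (\<lambda>p q. dist p q > \<epsilon>) S"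
  shows "finite S \<and> card S \<le> cover_num \<epsilon> E"
proof -
  obtain F where F: "finite F" "card F = cover_num \<epsilon> E"
    "\<And>U. U \<in> F \<Longrightarrow> bounded U \<and> diameter U \<le> \<epsilon>" "E \<subseteq> \<Union>F"
    using cover_num_attained[OF assms(1,2)] by metis
  have "\<forall>p\<in>S. \<exists>U\<in>F. p \<in> U" using F(4) assms(3) by blast
  then obtain u where u: "\<And>p. p \<in> S \<Longrightarrow> u p \<in> F \<and> p \<in> u p" by metis
  have "inj_on u S"
  proof (rule inj_onI, rule ccontr)
    fix p q assume pq: "p \<in> S" "q \<in> S" "u p = u q" "p \<noteq> q"
    then have "dist p q \<le> diameter (u p)"
      using u[of p] u[of q] F(3)[of "u p"] by (intro diameter_bounded_bound) auto
    moreover have "diameter (u p) \<le> \<epsilon>" using u F(3) pq by blast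
    ultimately show False using assms(4) pq by (force simp: pairwise_def)
  qed
  moreover have "u ` S \<subseteq> F" using u by blast
  ultimately show ?thesis
    using F(1,2) by (metis card_inj_on_le inj_on_finite)
qed

text \<open>By maximality every point of E is within \<epsilon>/2 of S, and closed balls of that
  radius have the diameter allowed in a cover. A largest S exists because cardinalities are bounded
  by the covering number at scale \<epsilon>/2.\<close>

lemma maximal_separated_subset:
  fixes E :: "(real^'n) set"
  assumes "bounded E" "\<epsilon> > 0"
  obtains S where "finite S" "S \<subseteq> E" "pairwise (\<lambda>p q. dist p q > \<epsilon>/2) S"
    "cover_num \<epsilon> E \<le> card S"
proof -
  let ?P = "\<lambda>S. S \<subseteq> E \<and> pairwise (\<lambda>p q. dist p q > \<epsilon>/2) S"
  have bd: "finite S \<and> card S \<le> cover_num (\<epsilon>/2) E" if "?P S" for S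
    using that assms by (intro card_separated_le_cover_num) auto
  have "\<exists>S. ?P S \<and> (\<forall>T. ?P T \<longrightarrow> card T \<le> card S)"
    by (rule ex_has_greatest_nat[where k = "{}" and b = "cover_num (\<epsilon>/2) E + 1"])
      (use bd in \<open>auto simp: pairwise_def less_Suc_eq_le\<close>)
  then obtain S where S: "?P S" and max: "\<And>T. ?P T \<Longrightarrow> card T \<le> card S" by blast
  have fin: "finite S" using bd S by blast
  have "E \<subseteq> \<Union>((\<lambda>c. cball c (\<epsilon>/2)) ` S)"
  proof (rule ccontr)
    assume "\<not> ?thesis"
    then obtain p where p: "p \<in> E" "\<And>q. q \<in> S \<Longrightarrow> dist q p > \<epsilon>/2" by fastforce
    then have "?P (insert p S)" using S by (auto simp: pairwise_insert dist_commute)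
    moreover have "p \<notin> S" using p(2)[of p] assms(2) by auto
    ultimately show False using max[of "insert p S"] fin by simp
  qed
  then have "cover_num \<epsilon> E \<le> card ((\<lambda>c. cball c (\<epsilon>/2)) ` S)"
    using fin assms(2) diameter_cball_half_le[of \<epsilon>] by (intro cover_num_le_card) auto
  then have "cover_num \<epsilon> E \<le> card S" using card_image_le[OF fin] le_trans by blast
  then show ?thesis using that fin S by blast
qed

section \<open>Upper box dimension: comparison, criteria, Lipschitz arcs\<close>

lemma eventually_less_one_at_right: "eventually (\<lambda>\<epsilon>::real. 0 < \<epsilon> \<and> \<epsilon> < 1) (at_right 0)"
  by (auto simp: eventually_at_right_field intro: exI[of _ 1])

lemma upper_box_dim_mono:
  fixes E E' :: "(real^'n) set"
  assumes "E \<subseteq> E'" "bounded E'"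
  shows "upper_box_dim E \<le> upper_box_dim E'"
  unfolding upper_box_dim_def
proof (rule Limsup_mono, rule eventually_mono[OF eventually_less_one_at_right])
  fix \<epsilon> :: real assume e: "0 < \<epsilon> \<and> \<epsilon> < 1"
  have le: "cover_num \<epsilon> E \<le> cover_num \<epsilon> E'" using cover_num_mono assms e by blast
  \<comment> \<open>The empty set has covering number 0, where monotonicity of the logarithm fails
    to apply; the convention \<open>ln 0 = 0\<close> settles these cases.\<close>
  have "ln (real (cover_num \<epsilon> E)) \<le> ln (real (cover_num \<epsilon> E'))"
    using le by (cases "cover_num \<epsilon> E = 0"; cases "cover_num \<epsilon> E' = 0") auto
  then show "ereal (ln (real (cover_num \<epsilon> E)) / ln (1 / \<epsilon>))
      \<le> ereal (ln (real (cover_num \<epsilon> E')) / ln (1 / \<epsilon>))"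
    using e by (auto intro!: divide_right_mono)
qed

lemma upper_box_dim_nonneg: "0 \<le> upper_box_dim E"
proof -
  have "0 \<le> Liminf (at_right 0) (\<lambda>\<epsilon>. ereal (ln (real (cover_num \<epsilon> E)) / ln (1 / \<epsilon>)))"
  proof (rule Liminf_bounded, rule eventually_mono[OF eventually_less_one_at_right])
    fix \<epsilon> :: real assume "0 < \<epsilon> \<and> \<epsilon> < 1"
    moreover have "ln (real (cover_num \<epsilon> E)) \<ge> 0" by (cases "cover_num \<epsilon> E = 0") auto
    ultimately show "0 \<le> ereal (ln (real (cover_num \<epsilon> E)) / ln (1 / \<epsilon>))" by auto
  qed
  also have "\<dots> \<le> upper_box_dim E"
    unfolding upper_box_dim_def by (rule Liminf_le_Limsup) simp
  finally show ?thesis .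
qed

text \<open>An upper limit is bounded below by good scales that are merely arbitrarily small. This
  allows a set built from one scale per radius to keep its dimension.\<close>

lemma upper_box_dim_ge:
  fixes E :: "(real^'n) set"
  assumes "\<And>d. d > 0 \<Longrightarrow> \<exists>\<epsilon>. 0 < \<epsilon> \<and> \<epsilon> < d \<and> \<epsilon> < 1 \<and> real (cover_num \<epsilon> E) \<ge> \<epsilon> powr (-s)"
  shows "ereal s \<le> upper_box_dim E"
proof (rule ccontr)
  assume "\<not> ?thesis"
  then have "eventually (\<lambda>\<epsilon>. ereal (ln (real (cover_num \<epsilon> E)) / ln (1 / \<epsilon>)) < ereal s) (at_right 0)"
    unfolding upper_box_dim_def by (intro Limsup_lessD) simp
  then obtain d where d: "d > 0"
    "\<And>\<epsilon>. 0 < \<epsilon> \<Longrightarrow> \<epsilon> < d \<Longrightarrow> ln (real (cover_num \<epsilon> E)) / ln (1 / \<epsilon>) < s"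
    by (auto simp: eventually_at_right_field)
  obtain \<epsilon> where e: "0 < \<epsilon>" "\<epsilon> < d" "\<epsilon> < 1" "real (cover_num \<epsilon> E) \<ge> \<epsilon> powr (-s)"
    using assms[OF d(1)] by blast
  have "ln (\<epsilon> powr (-s)) \<le> ln (real (cover_num \<epsilon> E))"
    using e less_le_trans[of 0 "\<epsilon> powr (-s)" "real (cover_num \<epsilon> E)"]
    by (subst ln_le_cancel_iff) auto
  then have "s * ln (1 / \<epsilon>) \<le> ln (real (cover_num \<epsilon> E))"
    using e by (simp add: ln_div ln_powr)
  then have "s \<le> ln (real (cover_num \<epsilon> E)) / ln (1 / \<epsilon>)"
    using e by (subst pos_le_divide_eq) auto
  then show False using d(2)[OF e(1,2)] by simp
qed

text \<open>\<open>P\<close> lets further smallness conditions be imposed on the good scale. The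
  disjunct with covering number 0 is for the empty set: its box dimension is 0 because
  \<open>ln 0 = 0\<close>, so a negative s lies below it although no positive power is at most
  0.\<close>

lemma upper_box_dim_gt:
  fixes E :: "(real^'n) set"
  assumes "ereal s < upper_box_dim E" "eventually P (at_right 0)"
  shows "\<exists>\<epsilon>. 0 < \<epsilon> \<and> \<epsilon> < 1 \<and> P \<epsilon> \<and> (cover_num \<epsilon> E = 0 \<or> \<epsilon> powr (-s) \<le> real (cover_num \<epsilon> E))"
proof (rule ccontr)
  assume contra: "\<not> ?thesis"
  have "upper_box_dim E \<le> ereal s"
    unfolding upper_box_dim_def
  proof (rule Limsup_bounded, rule eventually_mono[OF eventually_conj[OF eventually_less_one_at_right assms(2)]])
    fix \<epsilon> :: real assume e: "(0 < \<epsilon> \<and> \<epsilon> < 1) \<and> P \<epsilon>"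
    then have c: "cover_num \<epsilon> E \<noteq> 0" "real (cover_num \<epsilon> E) \<le> \<epsilon> powr (-s)"
      using contra by force+
    then have "ln (real (cover_num \<epsilon> E)) \<le> ln (\<epsilon> powr (-s))"
      using e by (subst ln_le_cancel_iff) auto
    then have "ln (real (cover_num \<epsilon> E)) \<le> s * ln (1 / \<epsilon>)"
      using e by (simp add: ln_div ln_powr)
    then show "ereal (ln (real (cover_num \<epsilon> E)) / ln (1 / \<epsilon>)) \<le> ereal s"
      using e by (simp add: pos_divide_le_eq)
  qed
  then show False using assms(1) by simp
qed

text \<open>Cutting the parameter interval into pieces of length proportional to \<epsilon> covers
  the arc by O(1/\<epsilon>) sets. Hence no direction contributes more than 1.\<close>

lemma upper_box_dim_lipschitz_arc_le:
  fixes \<gamma> :: "real \<Rightarrow> real^'n"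
  assumes "L-lipschitz_on {0..\<delta>} \<gamma>" "\<delta> > 0"
  shows "upper_box_dim (\<gamma> ` {0..\<delta>}) \<le> 1"
proof -
  let ?E = "\<gamma> ` {0..\<delta>}"
  have L: "L \<ge> 0" using assms(1) lipschitz_on_nonneg by blast
  define C where "C = (L + 1) * \<delta>"
  have C: "C > 0" using L assms(2) by (simp add: C_def)
  have cov: "real (cover_num \<epsilon> ?E) \<le> C / \<epsilon> + 2" if e: "\<epsilon> > 0" for \<epsilon>
  proof -
    \<comment> \<open>Dividing by L + 1 instead of L covers constant maps, where L may be 0.\<close>
    define h where "h = \<epsilon> / (L + 1)"
    have h: "h > 0" "L * h \<le> \<epsilon>" using e L by (auto simp: h_def field_simps)
    define J where "J i = {real i * h..real (Suc i) * h} \<inter> {0..\<delta>}" for i :: nat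
    \<comment> \<open>The piece that contains the endpoint \<delta> has index
      \<open>\<lfloor>\<delta> / h\<rfloor>\<close>, hence the successor.\<close>
    define N where "N = Suc (nat \<lfloor>\<delta> / h\<rfloor>)"
    have "bounded (\<gamma> ` J i) \<and> diameter (\<gamma> ` J i) \<le> \<epsilon>" for i
    proof
      have "bounded ?E"
        by (intro compact_imp_bounded compact_continuous_image compact_Icc
            lipschitz_on_continuous_on[OF assms(1)])
      then show "bounded (\<gamma> ` J i)" by (rule bounded_subset) (auto simp: J_def)
      show "diameter (\<gamma> ` J i) \<le> \<epsilon>"
      proof (rule diameter_le)
        fix y z assume "y \<in> \<gamma> ` J i" "z \<in> \<gamma> ` J i"
        then obtain a b where ab: "a \<in> J i" "b \<in> J i" "y = \<gamma> a" "z = \<gamma> b" by blast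
        then have "dist (\<gamma> a) (\<gamma> b) \<le> L * dist a b"
          using assms(1) by (auto simp: J_def intro: lipschitz_onD)
        also have "dist a b \<le> h" using ab by (auto simp: J_def dist_real_def algebra_simps)
        finally show "norm (y - z) \<le> \<epsilon>" using ab h L by (simp add: dist_norm mult_left_mono)
      qed (use e in auto)
    qed
    moreover have "?E \<subseteq> \<Union>((\<lambda>i. \<gamma> ` J i) ` {..<N})"
    proof
      fix y assume "y \<in> ?E"
      then obtain t where t: "0 \<le> t" "t \<le> \<delta>" "y = \<gamma> t" by auto
      define i where "i = nat \<lfloor>t / h\<rfloor>"
      have i: "real i = of_int \<lfloor>t / h\<rfloor>" using t h by (simp add: i_def)
      have "real i \<le> t / h" "t / h \<le> real i + 1" unfolding i by linarith+
      then have "t \<in> J i" using t h by (auto simp: J_def field_simps)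
      moreover have "i < N"
        unfolding i_def N_def less_Suc_eq_le using t h
        by (intro nat_mono floor_mono divide_right_mono) auto
      ultimately show "y \<in> \<Union>((\<lambda>i. \<gamma> ` J i) ` {..<N})" using t by blast
    qed
    ultimately have "cover_num \<epsilon> ?E \<le> card ((\<lambda>i. \<gamma> ` J i) ` {..<N})"
      by (intro cover_num_le_card) auto
    also have "\<dots> \<le> N" using card_image_le[of "{..<N}"] by simp
    finally have "real (cover_num \<epsilon> ?E) \<le> real N" by simp
    also have "real N \<le> \<delta> / h + 2" using h assms(2) by (simp add: N_def) linarith
    also have "\<delta> / h = C / \<epsilon>" using L by (simp add: h_def C_def)
    finally show ?thesis .
  qed
  have "upper_box_dim ?E \<le> Limsup (at_right 0) (\<lambda>\<epsilon>. ereal (ln (C / \<epsilon> + 2) / ln (1 / \<epsilon>)))"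
    unfolding upper_box_dim_def
  proof (rule Limsup_mono, rule eventually_mono[OF eventually_less_one_at_right])
    fix \<epsilon> :: real assume e: "0 < \<epsilon> \<and> \<epsilon> < 1"
    have pos: "C / \<epsilon> > 0" using e C by simp
    have "ln (real (cover_num \<epsilon> ?E)) \<le> ln (C / \<epsilon> + 2)"
      using cov[of \<epsilon>] e pos by (cases "cover_num \<epsilon> ?E = 0") auto
    then show "ereal (ln (real (cover_num \<epsilon> ?E)) / ln (1 / \<epsilon>)) \<le> ereal (ln (C / \<epsilon> + 2) / ln (1 / \<epsilon>))"
      using e by (auto intro!: divide_right_mono)
  qed
  also have "\<dots> = 1"
  proof (rule lim_imp_Limsup)
    have "((\<lambda>\<epsilon>. ln (C / \<epsilon> + 2) / ln (1 / \<epsilon>)) \<longlongrightarrow> 1) (at_right 0)"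
      using C by real_asymp
    then show "((\<lambda>\<epsilon>. ereal (ln (C / \<epsilon> + 2) / ln (1 / \<epsilon>))) \<longlongrightarrow> 1) (at_right 0)"
      by (simp add: one_ereal_def)
  qed simp
  finally show ?thesis .
qed

section \<open>Localization at a point\<close>

lemma in_closure_mono_local:
  fixes x :: "'a::metric_space"
  assumes "x \<in> closure A" "d > 0" "A \<inter> ball x d \<subseteq> B"
  shows "x \<in> closure B"
  unfolding closure_approachable
proof (intro allI impI)
  fix e :: real assume "e > 0"
  then obtain y where "y \<in> A" "dist y x < min e d"
    using assms(1,2) by (metis closure_approachable min_less_iff_conj)
  then show "\<exists>y\<in>B. dist y x < e" using assms(3) by (force simp: dist_commute)
qed

text \<open>The infimum over radii only sees small balls. Inclusion inside one ball, here and in the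
  later \<open>_local\<close> lemmas, is the common form of two needs: it follows from global
  inclusion, and used in both directions it gives locality.\<close>

lemma pbox_dim_mono_local:
  fixes E E' :: "(real^'n) set"
  assumes "d > 0" "E \<inter> ball x d \<subseteq> E'" "x \<in> closure E"
  shows "pbox_dim x E \<le> pbox_dim x E'"
proof -
  have "x \<in> closure E'" by (rule in_closure_mono_local[OF assms(3,1,2)])
  moreover have "(INF r\<in>{0<..}. upper_box_dim (E \<inter> ball x r)) \<le> (INF r\<in>{0<..}. upper_box_dim (E' \<inter> ball x r))"
  proof (rule INF_mono)
    fix r :: real assume "r \<in> {0<..}"
    then show "\<exists>r'\<in>{0<..}. upper_box_dim (E \<inter> ball x r') \<le> upper_box_dim (E' \<inter> ball x r)"
      using assms(1,2) by (intro bexI[of _ "min r d"] upper_box_dim_mono) (auto simp: bounded_Int)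
  qed
  ultimately show ?thesis using assms(3) by (simp add: pbox_dim_def)
qed

lemma pbox_dim_le_upper_box_dim:
  fixes E E' :: "(real^'n) set"
  assumes "E \<subseteq> E'" "bounded E'"
  shows "pbox_dim x E \<le> upper_box_dim E'"
proof (cases "x \<in> closure E")
  case True
  then have "pbox_dim x E \<le> upper_box_dim (E \<inter> ball x 1)"
    by (auto simp: pbox_dim_def intro: INF_lower)
  also have "\<dots> \<le> upper_box_dim E'" using assms by (intro upper_box_dim_mono) auto
  finally show ?thesis .
qed (simp add: pbox_dim_def upper_box_dim_nonneg)

section \<open>Separated sets near a point\<close>

lemma cover_num_insert_le:
  fixes E :: "(real^'n) set"
  assumes "bounded E" "\<epsilon> > 0"
  shows "cover_num \<epsilon> (insert x E) \<le> Suc (cover_num \<epsilon> E)"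
proof -
  obtain F where F: "finite F" "card F = cover_num \<epsilon> E"
    "\<And>U. U \<in> F \<Longrightarrow> bounded U \<and> diameter U \<le> \<epsilon>" "E \<subseteq> \<Union>F"
    using cover_num_attained[OF assms] by metis
  have "cover_num \<epsilon> (insert x E) \<le> card (insert {x} F)"
    using F assms(2) by (intro cover_num_le_card) (auto simp: diameter_singleton)
  also have "\<dots> \<le> Suc (cover_num \<epsilon> E)"
    using F by (simp add: card_insert_if)
  finally show ?thesis .
qed

text \<open>The point x is left out because it is to be the accumulation point of the chosen sets
  and must stay fixed. The scale \<epsilon>/5 anticipates a map that at most halves distances:
  images of points more than \<epsilon>/2 apart are more than \<epsilon>/4 apart, so they still
  count at scale \<epsilon>/5.\<close>

lemma large_separated_subset:
  fixes E :: "(real^'n) set"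
  assumes ne: "E \<inter> ball x r - {x} \<noteq> {}" and r: "r > 0"
    and s: "ereal s < upper_box_dim (E \<inter> ball x r)"
  obtains \<epsilon> S where "0 < \<epsilon>" "\<epsilon> < r" "\<epsilon> < 1" "finite S" "S \<subseteq> E \<inter> ball x r - {x}"
    "pairwise (\<lambda>p q. dist p q > \<epsilon>/2) S" "(\<epsilon>/5) powr (-s) \<le> real (card S)"
proof (cases "s \<le> 0")
  case True
  obtain p where p: "p \<in> E \<inter> ball x r - {x}" using ne by blast
  \<comment> \<open>For s \<le> 0 the required number is at most 1, so a single point is
    enough.\<close>
  have "(min r 1 / 2 / 5) powr (-s) \<le> 1" using True r by (intro powr_le1) auto
  then show ?thesis using p r by (intro that[of "min r 1 / 2" "{p}"]) auto
next
  case False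
  \<comment> \<open>The gap between s and s' pays, at small scales, for the factor 5 and for the one
    covering set spent on x.\<close>
  obtain s' where s': "ereal s < ereal s'" "ereal s' < upper_box_dim (E \<inter> ball x r)"
    using ereal_dense2[OF s] by blast
  have "s < s'" "0 < s" using s' False by auto
  then have "eventually (\<lambda>\<epsilon>. (\<epsilon>/5) powr (-s) \<le> \<epsilon> powr (-s') - 1) (at_right 0)"
    by real_asymp
  moreover have "eventually (\<lambda>\<epsilon>. \<epsilon> < r) (at_right 0)"
    using r by (auto simp: eventually_at_right_field)
  ultimately obtain \<epsilon> where e: "0 < \<epsilon>" "\<epsilon> < 1" "\<epsilon> < r" "(\<epsilon>/5) powr (-s) \<le> \<epsilon> powr (-s') - 1"
    and c: "cover_num \<epsilon> (E \<inter> ball x r) = 0 \<or> \<epsilon> powr (-s') \<le> real (cover_num \<epsilon> (E \<inter> ball x r))"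
    using upper_box_dim_gt[OF s'(2) eventually_conj[of "\<lambda>\<epsilon>. (\<epsilon>/5) powr (-s) \<le> \<epsilon> powr (-s') - 1" _
        "\<lambda>\<epsilon>. \<epsilon> < r"]] by blast
  have "cover_num \<epsilon> (E \<inter> ball x r) \<noteq> 0"
  proof
    assume z: "cover_num \<epsilon> (E \<inter> ball x r) = 0"
    obtain F where "finite F" "card F = cover_num \<epsilon> (E \<inter> ball x r)" "E \<inter> ball x r \<subseteq> \<Union>F"
      using cover_num_attained[of "E \<inter> ball x r" \<epsilon>] e by (metis bounded_Int bounded_ball)
    then show False using z ne by auto
  qed
  then have c': "\<epsilon> powr (-s') \<le> real (cover_num \<epsilon> (E \<inter> ball x r))" using c by simp
  obtain S where S: "finite S" "S \<subseteq> E \<inter> ball x r - {x}" "pairwise (\<lambda>p q. dist p q > \<epsilon>/2) S"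
    "cover_num \<epsilon> (E \<inter> ball x r - {x}) \<le> card S"
    using maximal_separated_subset[of "E \<inter> ball x r - {x}" \<epsilon>] e
    by (metis Diff_subset bounded_Int bounded_ball bounded_subset)
  have "cover_num \<epsilon> (E \<inter> ball x r) \<le> cover_num \<epsilon> (insert x (E \<inter> ball x r - {x}))"
    using e by (intro cover_num_mono) (auto intro: bounded_subset[OF bounded_ball[of x r]])
  also have "\<dots> \<le> Suc (cover_num \<epsilon> (E \<inter> ball x r - {x}))"
    using e by (intro cover_num_insert_le) (auto intro: bounded_subset[OF bounded_ball[of x r]])
  finally have "real (cover_num \<epsilon> (E \<inter> ball x r)) \<le> real (card S) + 1" using S(4) by linarith
  then show ?thesis using that[OF e(1,3,2) S(1-3)] e(4) c' by linarith
qed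

section \<open>Moving a locally finite set of points into a dense set\<close>

text \<open>The difference splits into a change of the normalizing factor and the term e / norm u,
  each of norm at most norm e / norm u. For e of order (norm u)^2 the direction therefore does not
  change in the limit.\<close>

lemma norm_normalize_diff_le:
  fixes u e :: "'a::real_normed_vector"
  assumes "u \<noteq> 0"
  shows "norm ((u + e) /\<^sub>R norm (u + e) - u /\<^sub>R norm u) \<le> 2 * norm e / norm u"
proof (cases "u + e = 0")
  \<comment> \<open>Here the normalized zero vector is 0 by the convention on
    \<open>inverse 0\<close>, and the bound reads 1 \<le> 2.\<close>
  case True
  then have "norm e = norm u" by (metis add_eq_0_iff norm_minus_cancel)
  then show ?thesis using True assms by simp
next
  case False
  define w where "w = u + e"
  have w: "norm w > 0" "norm u > 0" using False assms by (auto simp: w_def)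
  have "w /\<^sub>R norm w - u /\<^sub>R norm u = (inverse (norm w) - inverse (norm u)) *\<^sub>R w + e /\<^sub>R norm u"
    by (simp add: w_def algebra_simps)
  then have "norm (w /\<^sub>R norm w - u /\<^sub>R norm u)
      \<le> norm ((inverse (norm w) - inverse (norm u)) *\<^sub>R w) + norm (e /\<^sub>R norm u)"
    by (metis norm_triangle_ineq)
  also have "norm ((inverse (norm w) - inverse (norm u)) *\<^sub>R w) = \<bar>(inverse (norm w) - inverse (norm u)) * norm w\<bar>"
    by (simp add: abs_mult)
  also have "(inverse (norm w) - inverse (norm u)) * norm w = (norm u - norm w) / norm u"
    using w by (simp add: field_simps)
  also have "\<bar>(norm u - norm w) / norm u\<bar> \<le> norm e / norm u"
    using w norm_triangle_ineq3[of u w] by (auto simp: w_def intro!: divide_right_mono)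
  finally show ?thesis by (simp add: w_def divide_inverse mult.commute mult.left_commute)
qed

text \<open>The radii \<open>\<rho> q\<close> below make the balls around the points of \<open>Q\<close> disjoint. A bump of
  height at most \<open>\<rho> q / 2\<close> is at \<open>y\<close> bounded by half the distance \<open>\<rho> q - dist y q\<close> of \<open>y\<close> to the
  boundary of its ball; this makes a sum of bumps no steeper than a single one.\<close>

lemma small_perturbation:
  fixes x :: "'a::real_normed_vector"
  assumes xQ: "x \<notin> Q" and fin: "\<And>r. r > 0 \<Longrightarrow> finite (Q - ball x r)" and QA: "Q \<subseteq> closure A"
  obtains g :: "'a \<Rightarrow> 'a" where "\<And>y z. norm (g y - g z) \<le> norm (y - z) / 2"
    "\<And>y. norm (g y) \<le> 4 * (norm (y - x))\<^sup>2" "\<And>q. q \<in> Q \<Longrightarrow> q + g q \<in> A"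
proof -
  have "\<exists>\<rho>>0. \<forall>p\<in>insert x Q. p \<noteq> q \<longrightarrow> 2 * \<rho> \<le> dist q p" if q: "q \<in> Q" for q
  proof -
    \<comment> \<open>Points of \<open>insert x Q\<close> in \<open>ball x r\<close> are at least r
      away from q, since q is at distance 2r from x; outside that ball only finitely many points of
      Q remain.\<close>
    define r where "r = dist x q / 2"
    have r: "r > 0" using q xQ by (auto simp: r_def)
    obtain d where d: "d > 0" "\<And>p. p \<in> Q - ball x r \<Longrightarrow> p \<noteq> q \<Longrightarrow> d \<le> dist q p"
      using finite_set_avoid[OF fin[OF r], of q] by blast
    have "min d r \<le> dist q p" if "p \<in> insert x Q" "p \<noteq> q" for p
    proof (cases "p \<in> Q - ball x r")
      case False
      then have "dist x p < r" using that r by auto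
      then have "r \<le> dist q p"
        using dist_triangle[of x q p] by (simp add: r_def dist_commute)
      then show ?thesis by simp
    qed (use d(2)[of p] that in simp)
    then show ?thesis using d(1) r by (intro exI[of _ "min d r / 2"]) auto
  qed
  then obtain \<rho> where \<rho>: "\<And>q. q \<in> Q \<Longrightarrow> \<rho> q > 0"
    "\<And>q p. q \<in> Q \<Longrightarrow> p \<in> insert x Q \<Longrightarrow> p \<noteq> q \<Longrightarrow> 2 * \<rho> q \<le> dist q p"
    by metis
  \<comment> \<open>The first bound on the displacement gives slope at most 1/2, the second the
    quadratic decay at x.\<close>
  have "\<exists>p\<in>A. dist p q < min (\<rho> q / 2) ((dist q x)\<^sup>2)" if "q \<in> Q" for q
  proof -
    have "min (\<rho> q / 2) ((dist q x)\<^sup>2) > 0" using that \<rho>(1) xQ by auto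
    then show ?thesis using QA that by (meson closure_approachable subsetD)
  qed
  then obtain p where p: "\<And>q. q \<in> Q \<Longrightarrow> p q \<in> A"
    "\<And>q. q \<in> Q \<Longrightarrow> norm (p q - q) \<le> \<rho> q / 2" "\<And>q. q \<in> Q \<Longrightarrow> norm (p q - q) \<le> (dist q x)\<^sup>2"
    by (simp add: dist_norm) (metis less_imp_le)
  \<comment> \<open>Cones: the full displacement at q falls linearly to 0 at radius \<rho> q.
    Disjointness of the balls (\<open>uniq\<close>) makes the choice by \<open>SOME\<close>
    unambiguous.\<close>
  define g where "g y = (if \<exists>q\<in>Q. dist y q < \<rho> q
      then let q = SOME q. q \<in> Q \<and> dist y q < \<rho> q in (1 - dist y q / \<rho> q) *\<^sub>R (p q - q) else 0)" for y
  have uniq: "q = q'" if "q \<in> Q" "q' \<in> Q" "dist y q < \<rho> q" "dist y q' < \<rho> q'" for y q q'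
  proof (rule ccontr)
    assume "q \<noteq> q'"
    then have "2 * \<rho> q \<le> dist q q'" "2 * \<rho> q' \<le> dist q q'"
      using \<rho>(2)[of q q'] \<rho>(2)[of q' q] that by (auto simp: dist_commute)
    then show False using that dist_triangle3[of q q' y] by linarith
  qed
  have g_in: "g y = (1 - dist y q / \<rho> q) *\<^sub>R (p q - q)" if "q \<in> Q" "dist y q < \<rho> q" for y q
  proof -
    have "(SOME q. q \<in> Q \<and> dist y q < \<rho> q) = q" using that uniq by blast
    then show ?thesis unfolding g_def using that by auto
  qed
  have g_out: "g y = 0" if "\<not> (\<exists>q\<in>Q. dist y q < \<rho> q)" for y using that by (simp add: g_def)
  have g_le: "norm (g y) \<le> (\<rho> q - dist y q) / 2" if "q \<in> Q" "dist y q < \<rho> q" for y q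
  proof -
    have "norm (g y) = (1 - dist y q / \<rho> q) * norm (p q - q)"
      using that \<rho>(1)[OF that(1)] by (simp add: g_in)
    also have "\<dots> \<le> (1 - dist y q / \<rho> q) * (\<rho> q / 2)"
      using that \<rho>(1)[OF that(1)] p(2) by (intro mult_left_mono) auto
    also have "\<dots> = (\<rho> q - dist y q) / 2" using \<rho>(1)[OF that(1)] by (simp add: field_simps)
    finally show ?thesis .
  qed
  have in_out: "norm (g y - g z) \<le> dist y z / 2"
    if "q \<in> Q" "dist y q < \<rho> q" "\<not> (\<exists>q\<in>Q. dist z q < \<rho> q)" for y z q
  proof -
    have "dist z q \<ge> \<rho> q" using that by force
    then show ?thesis
      using g_le[OF that(1,2)] g_out[OF that(3)] dist_triangle3[of z q y] by simp
  qed
  have lip: "norm (g y - g z) \<le> dist y z / 2" for y z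
  proof (cases "\<exists>q\<in>Q. dist y q < \<rho> q")
    case True
    then obtain q where q: "q \<in> Q" "dist y q < \<rho> q" by blast
    show ?thesis
    proof (cases "\<exists>q\<in>Q. dist z q < \<rho> q")
      case True
      then obtain q' where q': "q' \<in> Q" "dist z q' < \<rho> q'" by blast
      show ?thesis
      proof (cases "q' = q")
        case True
        have pos: "\<rho> q > 0" using \<rho>(1) q by blast
        have "g y - g z = ((dist z q - dist y q) / \<rho> q) *\<^sub>R (p q - q)"
          using g_in[OF q] g_in[OF q'] True
          by (simp add: scaleR_left_diff_distrib[symmetric] diff_divide_distrib)
        then have "norm (g y - g z) = \<bar>dist z q - dist y q\<bar> / \<rho> q * norm (p q - q)"
          using pos by simp
        also have "\<dots> \<le> dist y z / \<rho> q * (\<rho> q / 2)"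
          using pos p(2)[OF q(1)] dist_triangle[of z q y] dist_triangle[of y q z]
          by (intro mult_mono divide_right_mono) (auto simp: dist_commute abs_le_iff)
        also have "\<dots> = dist y z / 2" using pos by simp
        finally show ?thesis .
      next
        case False
        \<comment> \<open>Together these give \<rho> q + \<rho> q' \<le> dist q q', so what the two
          distances to the boundaries add up to is at most dist y z.\<close>
        have "2 * \<rho> q \<le> dist q q'" "2 * \<rho> q' \<le> dist q q'"
          using \<rho>(2)[of q q'] \<rho>(2)[of q' q] q q' False by (auto simp: dist_commute)
        moreover have "dist q q' \<le> dist y q + dist y z + dist z q'"
          using dist_triangle[of q q' y] dist_triangle[of y q' z] by (simp add: dist_commute)
        moreover have "norm (g y - g z) \<le> norm (g y) + norm (g z)" by (rule norm_triangle_ineq4)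
        ultimately show ?thesis using g_le[OF q] g_le[OF q'] by (simp add: field_simps)
      qed
    qed (rule in_out[OF q])
  next
    case False
    show ?thesis
    proof (cases "\<exists>q\<in>Q. dist z q < \<rho> q")
      case True
      then obtain q where "q \<in> Q" "dist z q < \<rho> q" by blast
      then show ?thesis using in_out[of q z y] False by (simp add: dist_commute norm_minus_commute)
    qed (use g_out False in simp)
  qed
  have quad: "norm (g y) \<le> 4 * (norm (y - x))\<^sup>2" for y
  proof (cases "\<exists>q\<in>Q. dist y q < \<rho> q")
    case True
    then obtain q where q: "q \<in> Q" "dist y q < \<rho> q" by blast
    have pos: "\<rho> q > 0" using \<rho>(1) q by blast
    have "norm (g y) \<le> 1 * norm (p q - q)"
      unfolding g_in[OF q] norm_scaleR using q pos by (intro mult_right_mono) auto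
    also have "\<dots> \<le> (dist q x)\<^sup>2" using p(3) q by simp
    \<comment> \<open>The radii also respect x: y is within half of dist q x from q, so the
      distances of q and y to x are comparable. The factor 4 is the square of this 2.\<close>
    also have "\<dots> \<le> (2 * dist y x)\<^sup>2"
    proof (rule power_mono)
      have "2 * \<rho> q \<le> dist q x" using \<rho>(2)[of q x] q xQ by blast
      then show "dist q x \<le> 2 * dist y x"
        using q(2) dist_triangle3[of q x y] by linarith
    qed simp
    finally show ?thesis by (simp add: dist_norm power_mult_distrib)
  qed (simp add: g_out)
  have "q + g q \<in> A" if "q \<in> Q" for q using g_in[of q q] \<rho>(1) p(1) that by simp
  then show ?thesis using that[OF lip[unfolded dist_norm] quad] by blast
qed

text \<open>The strict bound by s passes to every ball about x because \<open>pbox_dim\<close> is an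
  infimum; each ball then supplies a large separated set at some scale.\<close>

lemma probe_into_dense_subset:
  fixes A :: "(real^'n) set"
  assumes pr: "(\<delta>, \<gamma>) \<in> probes (closure A) x v"
    and s: "ereal s < pbox_dim x (closure A \<inter> \<gamma> ` {0..\<delta>})"
  obtains \<gamma>' where "(\<delta>, \<gamma>') \<in> probes A x v" "ereal s \<le> pbox_dim x (A \<inter> \<gamma>' ` {0..\<delta>})"
proof -
  obtain L where \<delta>: "\<delta> > 0" and inj: "inj_on \<gamma> {0..\<delta>}" and lip: "L-lipschitz_on {0..\<delta>} \<gamma>"
    and \<gamma>0: "\<gamma> 0 = x"
    and dir: "((\<lambda>t. (\<gamma> t - x) /\<^sub>R norm (\<gamma> t - x)) \<longlongrightarrow> v) (at_right 0)"
    and hit: "\<And>\<eta>. 0 < \<eta> \<Longrightarrow> \<eta> \<le> \<delta> \<Longrightarrow> closure A \<inter> \<gamma> ` {0<..\<eta>} \<noteq> {}"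
    using pr by (auto simp: probes_def)
  have cont: "continuous_on {0..\<delta>} \<gamma>" using lip by (rule lipschitz_on_continuous_on)
  have L: "L \<ge> 0" using lip by (rule lipschitz_on_nonneg)
  have \<gamma>x: "\<gamma> t \<noteq> x" if "0 < t" "t \<le> \<delta>" for t
    using inj_onD[OF inj, of t 0] that \<gamma>0 by auto
  define E where "E = closure A \<inter> \<gamma> ` {0..\<delta>}"
  have ne: "E \<inter> ball x r - {x} \<noteq> {}" if r: "r > 0" for r
  proof -
    \<comment> \<open>With L + 1 in the denominator, L * c is strictly below r, also when L =
      0.\<close>
    define c where "c = r / (L + 1)"
    have "(L + 1) * c = r" using L by (simp add: c_def)
    then have "L * c + c = r" by (simp add: distrib_right)
    moreover have "c > 0" using L r by (simp add: c_def)
    ultimately have c: "c > 0" "L * c + c = r" by simp_all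
    define \<eta> where "\<eta> = min \<delta> c"
    have "0 < \<eta>" "\<eta> \<le> \<delta>" using \<delta> c by (auto simp: \<eta>_def)
    moreover have "L * \<eta> \<le> L * c" using L by (intro mult_left_mono) (auto simp: \<eta>_def)
    ultimately have \<eta>: "0 < \<eta>" "\<eta> \<le> \<delta>" "L * \<eta> < r" using c by linarith+
    obtain t where t: "0 < t" "t \<le> \<eta>" "\<gamma> t \<in> closure A" using hit[OF \<eta>(1,2)] by auto
    have "dist x (\<gamma> t) \<le> L * dist 0 t" using lipschitz_onD[OF lip, of 0 t] t \<eta> \<gamma>0 by auto
    also have "\<dots> \<le> L * \<eta>" using t L by (intro mult_left_mono) auto
    finally have "\<gamma> t \<in> E \<inter> ball x r" using t \<eta> by (auto simp: E_def)
    then show ?thesis using \<gamma>x[of t] t \<eta> by auto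
  qed
  have "x \<in> closure E"
    unfolding closure_approachable
  proof (intro allI impI)
    fix e :: real assume "e > 0"
    then obtain y where "y \<in> E \<inter> ball x e - {x}" using ne by blast
    then show "\<exists>y\<in>E. dist y x < e" by (auto simp: dist_commute)
  qed
  have dim: "ereal s < upper_box_dim (E \<inter> ball x r)" if "r > 0" for r
  proof -
    have "pbox_dim x E \<le> upper_box_dim (E \<inter> ball x r)"
      using that \<open>x \<in> closure E\<close> by (auto simp: pbox_dim_def intro: INF_lower)
    then show ?thesis using s by (simp add: E_def)
  qed
  have "\<exists>\<epsilon> S. 0 < \<epsilon> \<and> \<epsilon> < inverse (real (Suc k)) \<and> \<epsilon> < 1 \<and> finite S \<and>
      S \<subseteq> E \<inter> ball x (inverse (real (Suc k))) - {x} \<and>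
      pairwise (\<lambda>p q. dist p q > \<epsilon>/2) S \<and> (\<epsilon>/5) powr (-s) \<le> real (card S)" for k
  proof -
    have "inverse (real (Suc k)) > 0" by simp
    from large_separated_subset[OF ne[OF this] this dim[OF this]] show ?thesis by metis
  qed
  then obtain \<epsilon> S where \<epsilon>: "\<And>k. 0 < \<epsilon> k" "\<And>k. \<epsilon> k < inverse (real (Suc k))" "\<And>k. \<epsilon> k < 1"
    and S: "\<And>k. finite (S k)" "\<And>k. S k \<subseteq> E \<inter> ball x (inverse (real (Suc k))) - {x}"
      "\<And>k. pairwise (\<lambda>p q. dist p q > \<epsilon> k/2) (S k)" "\<And>k. (\<epsilon> k/5) powr (-s) \<le> real (card (S k))"
    by metis
  have S_ne: "S k \<noteq> {}" for k
  proof -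
    have "(\<epsilon> k/5) powr (-s) > 0" using \<epsilon>(1)[of k] by auto
    then have "card (S k) \<noteq> 0" using S(4)[of k] by linarith
    then show ?thesis by auto
  qed
  define Q where "Q = (\<Union>k. S k)"
  \<comment> \<open>Outside \<open>ball x r\<close> only those \<open>S k\<close> with inverse (k+1)
    not below r can have points, and each is finite.\<close>
  have Q_fin: "finite (Q - ball x r)" if r: "r > 0" for r
  proof -
    obtain K where K: "inverse (real (Suc K)) < r" using reals_Archimedean[OF r] by blast
    have "Q - ball x r \<subseteq> (\<Union>k\<in>{..K}. S k)"
    proof
      fix q assume q: "q \<in> Q - ball x r"
      then obtain k where k: "q \<in> S k" by (auto simp: Q_def)
      have "\<not> K < k"
      proof
        assume "K < k"
        then have "inverse (real (Suc k)) \<le> inverse (real (Suc K))" by (intro le_imp_inverse_le) auto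
        moreover have "dist x q < inverse (real (Suc k))" using k S(2)[of k] by auto
        moreover have "r \<le> dist x q" using q by simp
        ultimately show False using K by linarith
      qed
      then show "q \<in> (\<Union>k\<in>{..K}. S k)" using k by auto
    qed
    then show ?thesis using S(1) by (meson finite_UN_I finite_atMost finite_subset)
  qed
  have QE: "x \<notin> Q" "Q \<subseteq> E" using S(2) unfolding Q_def by blast+
  then have "Q \<subseteq> closure A" by (auto simp: E_def)
  then obtain g where g: "\<And>y z. norm (g y - g z) \<le> norm (y - z) / 2"
    "\<And>y. norm (g y) \<le> 4 * (norm (y - x))\<^sup>2" "\<And>q. q \<in> Q \<Longrightarrow> q + g q \<in> A"
    using small_perturbation[OF QE(1) Q_fin] by metis
  have gx: "g x = 0" using g(2)[of x] by simp
  define \<phi> where "\<phi> y = y + g y" for y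
  have \<phi>_lower: "dist y z / 2 \<le> dist (\<phi> y) (\<phi> z)" for y z
    using norm_triangle_ineq2[of "y - z" "g z - g y"] g(1)[of z y]
    by (simp add: \<phi>_def dist_norm algebra_simps norm_minus_commute)
  have \<phi>_upper: "dist (\<phi> y) (\<phi> z) \<le> 3/2 * dist y z" for y z
    using norm_triangle_ineq[of "y - z" "g y - g z"] g(1)[of y z]
    by (simp add: \<phi>_def dist_norm algebra_simps)
  have \<phi>x: "\<phi> x = x" by (simp add: \<phi>_def gx)
  have \<phi>A: "\<phi> q \<in> A" if "q \<in> Q" for q using g(3) that by (simp add: \<phi>_def)
  define \<gamma>' where "\<gamma>' t = \<phi> (\<gamma> t)" for t
  have SE: "q \<in> Q" "q \<in> E" "q \<noteq> x" "dist x q < inverse (real (Suc k))" if "q \<in> S k" for q k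
    using that S(2)[of k] by (auto simp: Q_def)
  have "inj_on \<gamma>' {0..\<delta>}"
  proof (rule inj_onI)
    fix a b assume ab: "a \<in> {0..\<delta>}" "b \<in> {0..\<delta>}" "\<gamma>' a = \<gamma>' b"
    then have "dist (\<gamma> a) (\<gamma> b) \<le> 0" using \<phi>_lower[of "\<gamma> a" "\<gamma> b"] by (simp add: \<gamma>'_def)
    then show "a = b" using inj_onD[OF inj] ab by simp
  qed
  moreover have "(3/2 * L)-lipschitz_on {0..\<delta>} \<gamma>'"
  proof (rule lipschitz_onI)
    fix a b assume ab: "a \<in> {0..\<delta>}" "b \<in> {0..\<delta>}"
    show "dist (\<gamma>' a) (\<gamma>' b) \<le> 3/2 * L * dist a b"
      using \<phi>_upper[of "\<gamma> a" "\<gamma> b"] lipschitz_onD[OF lip ab] by (simp add: \<gamma>'_def)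
  qed (use L in simp)
  moreover have "\<gamma>' 0 = x" by (simp add: \<gamma>'_def \<gamma>0 \<phi>x)
  moreover have "((\<lambda>t. (\<gamma>' t - x) /\<^sub>R norm (\<gamma>' t - x)) \<longlongrightarrow> v) (at_right 0)"
  proof -
    have ev: "eventually (\<lambda>t. 0 < t \<and> t \<le> \<delta>) (at_right 0)"
      using \<delta> by (auto simp: eventually_at_right_field intro: exI[of _ \<delta>])
    \<comment> \<open>The constant 8 is the factor 2 from normalization times the factor 4 in the
      quadratic bound on g.\<close>
    have "((\<lambda>t. 8 * norm (\<gamma> t - x)) \<longlongrightarrow> 0) (at_right 0)"
    proof (rule Lim_null_comparison)
      show "eventually (\<lambda>t. norm (8 * norm (\<gamma> t - x)) \<le> 8 * L * t) (at_right 0)"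
        using ev
      proof (rule eventually_mono)
        fix t assume "0 < t \<and> t \<le> \<delta>"
        then have "dist (\<gamma> t) (\<gamma> 0) \<le> L * dist t 0" by (intro lipschitz_onD[OF lip]) auto
        then show "norm (8 * norm (\<gamma> t - x)) \<le> 8 * L * t"
          using \<open>0 < t \<and> t \<le> \<delta>\<close> \<gamma>0 by (simp add: dist_norm)
      qed
      show "((\<lambda>t. 8 * L * t) \<longlongrightarrow> 0) (at_right 0)" by real_asymp
    qed
    then have "((\<lambda>t. (\<gamma>' t - x) /\<^sub>R norm (\<gamma>' t - x) - (\<gamma> t - x) /\<^sub>R norm (\<gamma> t - x)) \<longlongrightarrow> 0) (at_right 0)"
    proof (rule Lim_null_comparison[rotated])
      show "eventually (\<lambda>t. norm ((\<gamma>' t - x) /\<^sub>R norm (\<gamma>' t - x) - (\<gamma> t - x) /\<^sub>R norm (\<gamma> t - x))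
          \<le> 8 * norm (\<gamma> t - x)) (at_right 0)"
        using ev
      proof (rule eventually_mono)
        fix t assume t: "0 < t \<and> t \<le> \<delta>"
        define u where "u = \<gamma> t - x"
        have u: "u \<noteq> 0" using \<gamma>x t by (simp add: u_def)
        have \<gamma>': "\<gamma>' t - x = u + g (\<gamma> t)" by (simp add: \<gamma>'_def \<phi>_def u_def)
        have "norm ((u + g (\<gamma> t)) /\<^sub>R norm (u + g (\<gamma> t)) - u /\<^sub>R norm u) \<le> 2 * norm (g (\<gamma> t)) / norm u"
          by (rule norm_normalize_diff_le[OF u])
        also have "\<dots> \<le> 2 * (4 * (norm u)\<^sup>2) / norm u"
          using g(2)[of "\<gamma> t"] by (intro divide_right_mono) (auto simp: u_def)
        also have "\<dots> = 8 * norm u" using u by (simp add: power2_eq_square)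
        finally show "norm ((\<gamma>' t - x) /\<^sub>R norm (\<gamma>' t - x) - (\<gamma> t - x) /\<^sub>R norm (\<gamma> t - x))
          \<le> 8 * norm (\<gamma> t - x)" unfolding \<gamma>' u_def[symmetric] .
      qed
    qed
    from tendsto_add[OF this dir] show ?thesis by simp
  qed
  moreover have "A \<inter> \<gamma>' ` {0<..\<eta>} \<noteq> {}" if \<eta>: "0 < \<eta>" "\<eta> \<le> \<delta>" for \<eta>
  proof -
    \<comment> \<open>Closeness to x forces a small parameter: the arc over [\<eta>, \<delta>] is
      compact and misses x, so points of \<open>S k\<close> with k large must come from parameters
      below \<eta>.\<close>
    have "compact (\<gamma> ` {\<eta>..\<delta>})"
      using \<eta> by (intro compact_continuous_image continuous_on_subset[OF cont]) auto
    moreover have "x \<notin> \<gamma> ` {\<eta>..\<delta>}"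
    proof
      assume "x \<in> \<gamma> ` {\<eta>..\<delta>}"
      then obtain t where "\<eta> \<le> t" "t \<le> \<delta>" "x = \<gamma> t" by auto
      then show False using \<gamma>x[of t] \<eta> by simp
    qed
    ultimately obtain r where r: "r > 0" "\<And>y. y \<in> \<gamma> ` {\<eta>..\<delta>} \<Longrightarrow> r \<le> dist x y"
      using separate_point_closed compact_imp_closed by metis
    obtain k where k: "inverse (real (Suc k)) < r" using reals_Archimedean[OF r(1)] by blast
    obtain q where q: "q \<in> S k" using S_ne by blast
    obtain t where t: "0 \<le> t" "t \<le> \<delta>" "q = \<gamma> t" using SE(2)[OF q] by (auto simp: E_def)
    have "t \<noteq> 0" using SE(3)[OF q] t \<gamma>0 by auto
    moreover have "t < \<eta>"
    proof (rule ccontr)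
      assume "\<not> t < \<eta>"
      then have "r \<le> dist x q" using r(2)[of q] t by auto
      then show False using SE(4)[OF q] k by linarith
    qed
    ultimately show ?thesis using \<phi>A[OF SE(1)[OF q]] t
      by (intro ex_in_conv[THEN iffD1] exI[of _ "\<phi> q"] IntI image_eqI[of _ _ t]) (auto simp: \<gamma>'_def)
  qed
  ultimately have "(\<delta>, \<gamma>') \<in> probes A x v" using \<delta> by (auto simp: probes_def)
  moreover have "ereal s \<le> pbox_dim x (A \<inter> \<gamma>' ` {0..\<delta>})"
  proof -
    define E' where "E' = A \<inter> \<gamma>' ` {0..\<delta>}"
    \<comment> \<open>Since \<phi> fixes x and stretches distances by at most 3/2, points within r/2
      of x stay within r.\<close>
    have \<phi>S: "\<phi> ` S k \<subseteq> E' \<inter> ball x r" if k: "inverse (real (Suc k)) < r / 2" for k r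
    proof
      fix p assume "p \<in> \<phi> ` S k"
      then obtain q where q: "q \<in> S k" "p = \<phi> q" by blast
      then have "p \<in> E'" using SE(1,2)[OF q(1)] \<phi>A by (auto simp: E_def E'_def \<gamma>'_def)
      moreover have "dist x p \<le> 3/2 * dist x q" using \<phi>_upper[of x q] q \<phi>x by simp
      then have "dist x p < r"
        using SE(4)[OF q(1)] k zero_le_dist[of x q] by linarith
      ultimately show "p \<in> E' \<inter> ball x r" by simp
    qed
    have "x \<in> closure E'"
      unfolding closure_approachable
    proof (intro allI impI)
      fix e :: real assume "e > 0"
      then obtain k where "inverse (real (Suc k)) < e / 2" using reals_Archimedean[of "e/2"] by auto
      then have "\<phi> ` S k \<subseteq> E' \<inter> ball x e" by (rule \<phi>S)
      moreover obtain q where "q \<in> S k" using S_ne by blast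
      ultimately have "\<phi> q \<in> E' \<inter> ball x e" by blast
      then show "\<exists>y\<in>E'. dist y x < e" by (auto simp: dist_commute)
    qed
    moreover have "ereal s \<le> upper_box_dim (E' \<inter> ball x r)" if r: "r > 0" for r
    proof (rule upper_box_dim_ge)
      fix d :: real assume d: "d > 0"
      \<comment> \<open>This k puts the image of \<open>S k\<close> into \<open>ball x r\<close> and
        also makes the scale smaller than d, as \<open>\<epsilon> k\<close> is below inverse
        (k+1).\<close>
      obtain k where k: "inverse (real (Suc k)) < min d r / 2"
        using reals_Archimedean[of "min d r / 2"] d r by auto
      have "pairwise (\<lambda>p q. dist p q > \<epsilon> k / 5) (\<phi> ` S k)"
      proof (rule pairwiseI)
        fix p q assume "p \<in> \<phi> ` S k" "q \<in> \<phi> ` S k" "p \<noteq> q"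
        then obtain a b where ab: "a \<in> S k" "b \<in> S k" "p = \<phi> a" "q = \<phi> b" "a \<noteq> b" by blast
        then have "\<epsilon> k / 2 < dist a b" using S(3)[of k] by (auto simp: pairwise_def)
        then show "\<epsilon> k / 5 < dist p q" using \<phi>_lower[of a b] ab \<epsilon>(1)[of k] by simp
      qed
      then have "card (\<phi> ` S k) \<le> cover_num (\<epsilon> k / 5) (E' \<inter> ball x r)"
        using \<phi>S[of k r] k \<epsilon>(1)[of k] card_separated_le_cover_num[of "E' \<inter> ball x r" "\<epsilon> k / 5" "\<phi> ` S k"]
        by (simp add: bounded_Int)
      moreover have "inj_on \<phi> (S k)"
      proof (rule inj_onI)
        fix a b assume "\<phi> a = \<phi> b"
        then show "a = b" using \<phi>_lower[of a b] by simp
      qed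
      ultimately have "(\<epsilon> k / 5) powr (-s) \<le> real (cover_num (\<epsilon> k / 5) (E' \<inter> ball x r))"
        using S(4)[of k] by (simp add: card_image)
      then show "\<exists>\<epsilon>. 0 < \<epsilon> \<and> \<epsilon> < d \<and> \<epsilon> < 1 \<and> real (cover_num \<epsilon> (E' \<inter> ball x r)) \<ge> \<epsilon> powr (-s)"
        using \<epsilon>[of k] k d by (intro exI[of _ "\<epsilon> k / 5"]) auto
    qed
    ultimately show ?thesis by (auto simp: pbox_dim_def E'_def intro: INF_greatest)
  qed
  ultimately show ?thesis using that by blast
qed

section \<open>Tangent cones and effective directions\<close>

lemma tangent_cone_mono_local:
  assumes "d > 0" "A \<inter> ball x d \<subseteq> B"
  shows "tangent_cone x A \<subseteq> tangent_cone x B"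
proof
  fix v assume "v \<in> tangent_cone x A"
  then obtain X l where X: "\<And>k. X k \<in> A" "X \<longlonglongrightarrow> x" and l: "\<And>k. l k > (0::real)" "decseq l" "l \<longlonglongrightarrow> 0"
    and v: "(\<lambda>k. (X k - x) /\<^sub>R l k) \<longlonglongrightarrow> v"
    by (auto simp: tangent_cone_def)
  have "eventually (\<lambda>k. dist (X k) x < d) sequentially" using X(2) assms(1) by (rule tendstoD)
  then obtain N where N: "\<And>k. k \<ge> N \<Longrightarrow> dist (X k) x < d" by (auto simp: eventually_sequentially)
  have "X (k + N) \<in> B" for k using N[of "k + N"] X(1)[of "k + N"] assms(2) by (auto simp: dist_commute)
  moreover have "decseq (\<lambda>k. l (k + N))" using l(2) by (auto simp: decseq_def)
  ultimately show "v \<in> tangent_cone x B"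
    unfolding tangent_cone_def using l(1)
      LIMSEQ_ignore_initial_segment[OF X(2), of N] LIMSEQ_ignore_initial_segment[OF l(3), of N]
      LIMSEQ_ignore_initial_segment[OF v, of N]
    by (intro CollectI exI[of _ "\<lambda>k. X (k + N)"] exI[of _ "\<lambda>k. l (k + N)"]) auto
qed

text \<open>Replacing X k by a point of A with error o(l k) changes neither the limit of the points
  nor that of the quotients, so the scales can be kept.\<close>

lemma tangent_cone_closure: "tangent_cone x (closure A) = tangent_cone x A"
proof
  show "tangent_cone x A \<subseteq> tangent_cone x (closure A)"
    using closure_subset[of A] by (intro tangent_cone_mono_local[of 1]) auto
  show "tangent_cone x (closure A) \<subseteq> tangent_cone x A"
  proof
    fix v assume "v \<in> tangent_cone x (closure A)"
    then obtain X l where X: "\<And>k. X k \<in> closure A" "X \<longlonglongrightarrow> x"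
      and l: "\<And>k. l k > (0::real)" "decseq l" "l \<longlonglongrightarrow> 0"
      and v: "(\<lambda>k. (X k - x) /\<^sub>R l k) \<longlonglongrightarrow> v"
      by (auto simp: tangent_cone_def)
    \<comment> \<open>The factor l k in the tolerance makes the error tend to 0 even after division
      by l k.\<close>
    have "\<exists>y\<in>A. dist y (X k) < l k * inverse (real (Suc k))" for k
      using X(1)[of k] l(1)[of k] unfolding closure_approachable by simp
    then obtain Y where Y: "\<And>k. Y k \<in> A" "\<And>k. dist (Y k) (X k) < l k * inverse (real (Suc k))"
      by metis
    have quot: "(\<lambda>k. (Y k - X k) /\<^sub>R l k) \<longlonglongrightarrow> 0"
    proof (rule Lim_null_comparison[OF always_eventually LIMSEQ_inverse_real_of_nat], intro allI)
      fix k
      have "norm ((Y k - X k) /\<^sub>R l k) = dist (Y k) (X k) / l k"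
        using l(1)[of k] by (simp add: dist_norm divide_inverse mult.commute)
      also have "\<dots> \<le> inverse (real (Suc k))"
        using Y(2)[of k] l(1)[of k] by (simp only: pos_divide_le_eq mult.commute[of "l k"] less_imp_le)
      finally show "norm ((Y k - X k) /\<^sub>R l k) \<le> inverse (real (Suc k))" .
    qed
    have "(\<lambda>k. l k *\<^sub>R ((Y k - X k) /\<^sub>R l k)) \<longlonglongrightarrow> 0 *\<^sub>R 0" by (intro tendsto_scaleR l(3) quot)
    moreover have "l k *\<^sub>R ((Y k - X k) /\<^sub>R l k) = Y k - X k" for k using l(1)[of k] by simp
    ultimately have "(\<lambda>k. Y k - X k) \<longlonglongrightarrow> 0" by simp
    from tendsto_add[OF X(2) this] have "Y \<longlonglongrightarrow> x" by simp
    moreover from tendsto_add[OF v quot] have "(\<lambda>k. (Y k - x) /\<^sub>R l k) \<longlonglongrightarrow> v"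
      by (simp add: scaleR_right_distrib[symmetric])
    ultimately show "v \<in> tangent_cone x A"
      unfolding tangent_cone_def using Y(1) l by blast
  qed
qed

lemma eff_dirs_mono_local:
  assumes "x \<in> closure A" "d > 0" "A \<inter> ball x d \<subseteq> B"
  shows "eff_dirs x A \<subseteq> eff_dirs x B"
  using assms(1) tangent_cone_mono_local[OF assms(2,3)] in_closure_mono_local[OF assms]
  by (auto simp: eff_dirs_def)

lemma eff_dirs_closure: "eff_dirs x (closure A) = eff_dirs x A"
  by (simp add: eff_dirs_def tangent_cone_closure)

section \<open>Directional contributions\<close>

lemma probes_D:
  assumes "(\<delta>, \<gamma>) \<in> probes A x v"
  shows "\<delta> > 0" "\<exists>L. L-lipschitz_on {0..\<delta>} \<gamma>" "\<gamma> 0 = x"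
    "\<And>\<eta>. 0 < \<eta> \<Longrightarrow> \<eta> \<le> \<delta> \<Longrightarrow> A \<inter> \<gamma> ` {0<..\<eta>} \<noteq> {}"
  using assms by (auto simp: probes_def)

lemma probe_near_start:
  assumes "(\<delta>, \<gamma>) \<in> probes A x v" "d > 0"
  obtains \<eta> where "0 < \<eta>" "\<eta> \<le> \<delta>" "\<gamma> ` {0<..\<eta>} \<subseteq> ball x d"
proof -
  note p = probes_D[OF assms(1)]
  have "continuous_on {0..\<delta>} \<gamma>" using p(2) lipschitz_on_continuous_on by blast
  then obtain c where c: "c > 0" "\<And>t. t \<in> {0..\<delta>} \<Longrightarrow> dist t 0 < c \<Longrightarrow> dist (\<gamma> t) (\<gamma> 0) < d"
    using p(1) assms(2) unfolding continuous_on_iff by (metis atLeastAtMost_iff less_imp_le order_refl)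
  show ?thesis
    using p(1,3) c by (intro that[of "min \<delta> (c / 2)"]) (auto simp: dist_commute)
qed

text \<open>Ensures that inside \<open>theta\<close> the value of \<open>pbox_dim\<close> is always
  the infimum and never the default 0.\<close>

lemma closure_probe_trace:
  assumes "(\<delta>, \<gamma>) \<in> probes A x v"
  shows "x \<in> closure (A \<inter> \<gamma> ` {0..\<delta>})"
  unfolding closure_approachable
proof (intro allI impI)
  fix e :: real assume "e > 0"
  then obtain \<eta> where \<eta>: "0 < \<eta>" "\<eta> \<le> \<delta>" "\<gamma> ` {0<..\<eta>} \<subseteq> ball x e"
    using probe_near_start[OF assms] by metis
  obtain t where t: "0 < t" "t \<le> \<eta>" "\<gamma> t \<in> A" using probes_D(4)[OF assms \<eta>(1,2)] by auto
  then have "\<gamma> t \<in> \<gamma> ` {0<..\<eta>}" by simp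
  then have "\<gamma> t \<in> ball x e" using \<eta>(3) by blast
  then show "\<exists>y\<in>A \<inter> \<gamma> ` {0..\<delta>}. dist y x < e"
    using t \<eta>(2) by (intro bexI[of _ "\<gamma> t"]) (auto simp: dist_commute)
qed

text \<open>The probe is kept with its full interval: a hit of A at a parameter small enough for the
  curve to be in the ball is a hit of B.\<close>

lemma probes_mono_local:
  assumes "d > 0" "A \<inter> ball x d \<subseteq> B"
  shows "probes A x v \<subseteq> probes B x v"
proof (rule subrelI)
  fix \<delta> \<gamma> assume pr: "(\<delta>, \<gamma>) \<in> probes A x v"
  obtain c where c: "0 < c" "c \<le> \<delta>" "\<gamma> ` {0<..c} \<subseteq> ball x d"
    using probe_near_start[OF pr assms(1)] by metis
  have "B \<inter> \<gamma> ` {0<..\<eta>} \<noteq> {}" if "0 < \<eta>" "\<eta> \<le> \<delta>" for \<eta>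
  proof -
    have "0 < min \<eta> c" "min \<eta> c \<le> \<delta>" using that c by auto
    from probes_D(4)[OF pr this] obtain t where "t \<in> {0<..min \<eta> c}" and t: "\<gamma> t \<in> A"
      by blast
    then have "\<gamma> t \<in> \<gamma> ` {0<..c}" "\<gamma> t \<in> \<gamma> ` {0<..\<eta>}" by auto
    then have "\<gamma> t \<in> B" "\<gamma> t \<in> \<gamma> ` {0<..\<eta>}" using c(3) t assms(2) by blast+
    then show ?thesis by blast
  qed
  then show "(\<delta>, \<gamma>) \<in> probes B x v" using pr by (auto simp: probes_def)
qed

lemma theta_mono_local:
  assumes "d > 0" "A \<inter> ball x d \<subseteq> B"
  shows "theta A x v \<le> theta B x v"
  unfolding theta_def
proof (rule SUP_mono)
  fix p assume p: "p \<in> probes A x v"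
  obtain \<delta> \<gamma> where [simp]: "p = (\<delta>, \<gamma>)" by force
  have "pbox_dim x (A \<inter> \<gamma> ` {0..\<delta>}) \<le> pbox_dim x (B \<inter> \<gamma> ` {0..\<delta>})"
    using assms closure_probe_trace[of \<delta> \<gamma> A x v] p by (intro pbox_dim_mono_local[of d]) auto
  then show "\<exists>q\<in>probes B x v. (case p of (\<delta>, \<gamma>) \<Rightarrow> pbox_dim x (A \<inter> \<gamma> ` {0..\<delta>}))
      \<le> (case q of (\<delta>, \<gamma>) \<Rightarrow> pbox_dim x (B \<inter> \<gamma> ` {0..\<delta>}))"
    using probes_mono_local[OF assms, of v] p by (intro bexI[of _ p]) auto
qed

text \<open>The loss in moving a probe disappears in the supremum, since every real s below the old
  value is reached by some probe for A. Among infinite s, one is excluded by the strict bound and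
  the other is trivial.\<close>

lemma theta_closure_le: "theta (closure A) x v \<le> theta A x v"
  unfolding theta_def
proof (rule SUP_least)
  fix p assume p: "p \<in> probes (closure A) x v"
  obtain \<delta> \<gamma> where [simp]: "p = (\<delta>, \<gamma>)" by force
  have "pbox_dim x (closure A \<inter> \<gamma> ` {0..\<delta>})
      \<le> (SUP (\<delta>, \<gamma>)\<in>probes A x v. pbox_dim x (A \<inter> \<gamma> ` {0..\<delta>}))" (is "_ \<le> ?S")
  proof (rule dense_le)
    fix s assume s: "s < pbox_dim x (closure A \<inter> \<gamma> ` {0..\<delta>})"
    show "s \<le> ?S"
    proof (cases s)
      case (real s')
      then obtain \<gamma>' where "(\<delta>, \<gamma>') \<in> probes A x v" "s \<le> pbox_dim x (A \<inter> \<gamma>' ` {0..\<delta>})"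
        using probe_into_dense_subset[of \<delta> \<gamma> A x v s'] p s by auto
      then show ?thesis by (intro SUP_upper2[of "(\<delta>, \<gamma>')"]) auto
    qed (use s in auto)
  qed
  then show "(case p of (\<delta>, \<gamma>) \<Rightarrow> pbox_dim x (closure A \<inter> \<gamma> ` {0..\<delta>})) \<le> ?S" by simp
qed

text \<open>\<open>theta\<close> is \<open>-\<infinity>\<close>, the supremum of the empty set, in directions without probes; upper
  bounds and monotonicity are not affected by this.\<close>

lemma theta_le_one: "theta A x v \<le> 1"
  unfolding theta_def
proof (rule SUP_least)
  fix p assume p: "p \<in> probes A x v"
  obtain \<delta> \<gamma> where [simp]: "p = (\<delta>, \<gamma>)" by force
  obtain L where L: "L-lipschitz_on {0..\<delta>} \<gamma>" "\<delta> > 0" using p probes_D[of \<delta> \<gamma> A x v] by auto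
  have "bounded (\<gamma> ` {0..\<delta>})"
    by (intro compact_imp_bounded compact_continuous_image lipschitz_on_continuous_on[OF L(1)]) simp
  then have "pbox_dim x (A \<inter> \<gamma> ` {0..\<delta>}) \<le> upper_box_dim (\<gamma> ` {0..\<delta>})"
    by (intro pbox_dim_le_upper_box_dim) auto
  also have "\<dots> \<le> 1" by (rule upper_box_dim_lipschitz_arc_le[OF L])
  finally show "(case p of (\<delta>, \<gamma>) \<Rightarrow> pbox_dim x (A \<inter> \<gamma> ` {0..\<delta>})) \<le> 1" by simp
qed

section \<open>The point-cross dimension\<close>

text \<open>Independence refers to the lines alone, so every family admissible for A stays
  admissible for B. The supremum over representatives of a line also grows, in its index set and in
  its values.\<close>

lemma cross_dim_at_mono:
  assumes "eff_dirs x A \<subseteq> eff_dirs x B" "\<And>v. theta A x v \<le> theta B x v"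
  shows "cross_dim_at x A \<le> cross_dim_at x B"
proof -
  have th: "theta_proj A x \<xi> \<le> theta_proj B x \<xi>" for \<xi>
    unfolding theta_proj_def using assms by (intro SUP_mono) blast
  have dirs: "proj_eff_dirs x A \<subseteq> proj_eff_dirs x B"
    using assms(1) by (auto simp: proj_eff_dirs_def)
  show ?thesis
    unfolding cross_dim_at_def
  proof (rule SUP_least, clarify)
    fix m \<xi>
    assume "m \<le> CARD('a)" "\<forall>i\<in>{1..m}. \<xi> i \<in> proj_eff_dirs x A" "proj_independent m \<xi>"
    then show "(\<Sum>i=1..m. theta_proj A x (\<xi> i)) \<le>
      (SUP (m, \<xi>)\<in>{(m, \<xi>). m \<le> CARD('a) \<and> (\<forall>i\<in>{1..m}. \<xi> i \<in> proj_eff_dirs x B) \<and>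
          proj_independent m \<xi>}. \<Sum>i=1..m. theta_proj B x (\<xi> i))"
      using dirs by (intro SUP_upper2[of "(m, \<xi>)"]) (auto intro: sum_mono th)
  qed
qed

lemma cross_dim_at_mono_local:
  assumes "x \<in> closure A" "d > 0" "A \<inter> ball x d \<subseteq> B"
  shows "cross_dim_at x A \<le> cross_dim_at x B"
  by (rule cross_dim_at_mono[OF eff_dirs_mono_local[OF assms] theta_mono_local[OF assms(2,3)]])

lemma cross_dim_at_closure:
  assumes "x \<in> closure A"
  shows "cross_dim_at x (closure A) = cross_dim_at x A"
proof (rule antisym)
  show "cross_dim_at x (closure A) \<le> cross_dim_at x A"
    by (intro cross_dim_at_mono theta_closure_le) (simp add: eff_dirs_closure)
  show "cross_dim_at x A \<le> cross_dim_at x (closure A)"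
    using closure_subset[of A] assms by (intro cross_dim_at_mono_local[of _ _ 1]) auto
qed

text \<open>The empty family gives the bound, whatever the signs of the contributions; with m = 0
  the second component is arbitrary.\<close>

lemma cross_dim_at_nonneg: "0 \<le> cross_dim_at x A"
  unfolding cross_dim_at_def
  by (rule SUP_upper2[of "(0, \<lambda>_. {})"]) (auto simp: proj_independent_def independent_empty)

text \<open>Each contribution is at most 1, so the sum is at most m, and m independent unit tangent
  vectors force m to be at most the dimension of their span.\<close>

lemma cross_dim_at_le_ptan_dim: "cross_dim_at x A \<le> ereal (real (ptan_dim x A))"
  unfolding cross_dim_at_def
proof (rule SUP_least, clarsimp)
  fix m and \<xi> :: "nat \<Rightarrow> (real^'a) set"
  assume \<xi>: "\<forall>i\<in>{Suc 0..m}. \<xi> i \<in> proj_eff_dirs x A" and ind: "proj_independent m \<xi>"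
  have "\<forall>i\<in>{1..m}. \<exists>w. w \<in> eff_dirs x A \<and> \<xi> i = proj_pt w"
    using \<xi> by (auto simp: proj_eff_dirs_def)
  then obtain w where w: "\<And>i. i \<in> {1..m} \<Longrightarrow> w i \<in> eff_dirs x A \<and> \<xi> i = proj_pt (w i)"
    by metis
  \<comment> \<open>\<open>proj_independent\<close> speaks of all nonzero representatives, so the
    unit tangent vectors may be inserted.\<close>
  have "w i \<in> \<xi> i \<and> w i \<noteq> 0" if "i \<in> {1..m}" for i
  proof
    show "w i \<in> \<xi> i" using w[OF that] by (auto simp: proj_pt_def intro: image_eqI[of _ _ 1])
    show "w i \<noteq> 0" using w[OF that] by (auto simp: eff_dirs_def split: if_splits)
  qed
  then have inj: "inj_on w {1..m}" and indep: "independent (w ` {1..m})"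
    using ind by (auto simp: proj_independent_def)
  have "eff_dirs x A \<subseteq> tangent_cone x A" by (auto simp: eff_dirs_def)
  then have "w ` {1..m} \<subseteq> tangent_cone x A" using w by blast
  then have "card (w ` {1..m}) \<le> ptan_dim x A"
    unfolding ptan_dim_def using indep span_superset
    by (intro independent_card_le_dim) auto
  then have "m \<le> ptan_dim x A" using inj by (simp add: card_image)
  have "(\<Sum>i=1..m. theta_proj A x (\<xi> i)) \<le> (\<Sum>i=1..m. 1)"
    unfolding theta_proj_def by (intro sum_mono SUP_least theta_le_one)
  also have "\<dots> = ereal (real m)"
    by (induction m) (auto simp: one_ereal_def zero_ereal_def)
  also have "\<dots> \<le> ereal (real (ptan_dim x A))" using \<open>m \<le> ptan_dim x A\<close> by simp
  finally show "(\<Sum>i=Suc 0..m. theta_proj A x (\<xi> i)) \<le> ereal (real (ptan_dim x A))" by simp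
qed

lemma cross_dim_at_cong_closure:
  assumes "closure A = closure B" "x \<in> closure A"
  shows "cross_dim_at x A = cross_dim_at x B"
  using assms cross_dim_at_closure[of x A] cross_dim_at_closure[of x B] by simp

theorem proposition4p1:
  fixes A B :: "(real^'n) set" and x :: "real^'n"
  shows
    "(x \<in> closure A \<longrightarrow>
        0 \<le> cross_dim_at x A \<and>
        cross_dim_at x A \<le> ereal (real (ptan_dim x A)) \<and>
        ptan_dim x A \<le> CARD('n)) \<and>
     (x \<in> closure A \<inter> closure B \<and> (\<exists>U. x \<in> interior U \<and> A \<inter> U = B \<inter> U) \<longrightarrow>
        cross_dim_at x A = cross_dim_at x B) \<and>
     (A \<subseteq> B \<longrightarrow> (\<forall>y\<in>closure A. cross_dim_at y A \<le> cross_dim_at y B)) \<and>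
     (\<forall>y\<in>closure A. cross_dim_at y A = cross_dim_at y (closure A)) \<and>
     (\<forall>D. D \<subseteq> A \<longrightarrow>
        (A \<subseteq> closure D \<longleftrightarrow> closure D = closure A) \<and>
        (A \<subseteq> closure D \<longrightarrow>
           (\<forall>y\<in>closure A. cross_dim_at y D = cross_dim_at y A) \<and> cross_dim D = cross_dim A))"
proof (intro conjI impI allI)
  show "0 \<le> cross_dim_at x A" by (rule cross_dim_at_nonneg)
  show "cross_dim_at x A \<le> ereal (real (ptan_dim x A))" by (rule cross_dim_at_le_ptan_dim)
  show "ptan_dim x A \<le> CARD('n)" unfolding ptan_dim_def by (rule dim_subset_UNIV_cart)
next
  assume "x \<in> closure A \<inter> closure B \<and> (\<exists>U. x \<in> interior U \<and> A \<inter> U = B \<inter> U)"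
  then obtain U where x: "x \<in> closure A" "x \<in> closure B" and U: "x \<in> interior U" "A \<inter> U = B \<inter> U"
    by blast
  obtain d where d: "d > 0" "ball x d \<subseteq> U" using U(1) by (auto simp: mem_interior)
  \<comment> \<open>Locality is local monotonicity used in both directions.\<close>
  have "A \<inter> ball x d \<subseteq> B" "B \<inter> ball x d \<subseteq> A" using d(2) U(2) by blast+
  then show "cross_dim_at x A = cross_dim_at x B"
    using x d(1) by (intro antisym cross_dim_at_mono_local)
next
  assume "A \<subseteq> B"
  then show "\<forall>y\<in>closure A. cross_dim_at y A \<le> cross_dim_at y B"
    by (intro ballI cross_dim_at_mono_local[of _ _ 1]) auto
next
  show "\<forall>y\<in>closure A. cross_dim_at y A = cross_dim_at y (closure A)"
    by (simp add: cross_dim_at_closure)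
next
  fix D assume DA: "D \<subseteq> A"
  show dense: "A \<subseteq> closure D \<longleftrightarrow> closure D = closure A"
    using DA closure_mono[OF DA] closure_minimal[of A "closure D"] closure_subset[of A] by auto
  assume "A \<subseteq> closure D"
  then have cl: "closure D = closure A" using dense by blast
  show eq: "\<forall>y\<in>closure A. cross_dim_at y D = cross_dim_at y A"
    using cross_dim_at_cong_closure[OF cl] cl by simp
  \<comment> \<open>\<open>cross_dim\<close> treats the empty set separately, so emptiness has to be
    compared as well.\<close>
  have "D = {} \<longleftrightarrow> A = {}" using cl closure_eq_empty by metis
  then show "cross_dim D = cross_dim A" using eq cl by (simp add: cross_dim_def cong: SUP_cong)
qed

end
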